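(* Consider an instance of the semi-infinite convex program (SICP) satisfying Assumptions 1 and 2 (both stated in the context), with $\eta$ and $B$ the constants of Assumption 1, and an execution of the central cutting surface algorithm described in the context on this instance. Let $\hat k$ be the first iteration with $\sigma^{(\hat k)}<\eta/B$. Then beyond iteration $\hat k$ the algorithm converges linearly in objective function value between consecutive feasibility cuts; that is, there is a constant $q<1$, independent of $k$, such that for every iteration $k>\hat k$ in which no feasibility cut is added (so that $y^{(k)}=x^{(k)}$) and in which $y_0^{(k-1)}>x_0^*$, $$\frac{y_0^{(k)}-x_0^*}{y_0^{(k-1)}-x_0^*}\le q .$$
   Context: **Problem (SICP).** Minimize $x_0$ subject to $g(x,t)\le 0$ for all $t\in T$ and $x\in X$, where $X\subseteq\mathbb{R}^n$, $x_0$ denotes the first coordinate of $x\in\mathbb{R}^n$, $T$ is an arbitrary index set, and $g$ is a real-valued function of $x$ and $t\in T$. **Assumption 1.** (1) $X$ is convex, closed and bounded. (2) There exist a Slater point $\bar x\in X$ and $\eta>0$ with $g(\bar x,t)\le-\eta$ for every $t\in T$. (3) For every $t\in T$, $g(\cdot,t)$ is convex and subdifferentiable (on an open convex set containing $X$, with respect to which subgradients are taken), and there is $B>0$ such that for every $x\in X$, $t\in T$, every subgradient $d\in\partial_x g(x,t)$ satisfies $\|d\|\le B$. **Optimality notions.** Let $\varepsilon\ge0$. A point $x\in X$ is $\varepsilon$-feasible if $g(x,t)\le\varepsilon$ for every $t\in T$. Let $x^*$ be an optimal solution of (SICP) (the minimum is attained), so $x_0^*$ is the optimal value. **Assumption 2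 (oracle, with tolerance $\varepsilon$).** For every $x\in X$ that is not $\varepsilon$-feasible, the oracle returns some $t\in T$ with $g(x,t)>0$. (For $\varepsilon$-feasible $x\in X$ the oracle may return either some $t\in T$ with $g(x,t)>0$, or report that none was found.) **Central cutting surface algorithm.** Parameters: a strict upper bound $U$ on the optimal value of (SICP); $B>0$ for which Assumption 1 holds; $\varepsilon\ge0$ for which Assumption 2 holds; $\beta>1$ ($\beta=\infty$, meaning no cuts are dropped, is allowed). - Step 1. Set $k=1$, $y^{(0)}=(U,0,\dots,0)\in\mathbb{R}^n$, $J^{(0)}=\emptyset$. - Step 2. Determine an optimal solution $(x^{(k)},\sigma^{(k)})$ of the master problem: maximize $\sigma$ over $(x,\sigma)$ subject to $x_0+\sigma\le y_0^{(k-1)}$; $g(x,t^{(j)})+\sigma s^{(j)}\le0$ for all $j\in J^{(k-1)}$; $x\in X$. - Step 3. If $\sigma^{(k)}=0$, stop and return $y^{(k-1)}$. - Step 4. Call the oracle to find $t^{(k)}\in T$ with $g(x^{(k)},t^{(k)})>0$. If none is found, go to Step 6. - Step 5 (feasibility cut). Set $J^{(k)}=J^{(k-1)}\cup\{k\}$, $y^{(k)}=y^{(k-1)}$, and choose a centering parameter $s^{(k)}$. Go to Step 7. - Step 6 (optimality cut). Set $J^{(k)}=J^{(k-1)}$, $y^{(k)}=x^{(k)}$. - Step 7 (drop cuts). Let $D=\{j\in J^{(k)} : \sigma^{(j)}\ge\beta\sigma^{(k)}\text{ and } g(x^{(k)},t^{(j)})+\sigma^{(k)}s^{(j)}<0\}$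 and replace $J^{(k)}$ by $J^{(k)}\setminus D$. - Step 8. Increase $k$ by one and go to Step 2. **Centering parameters.** They are chosen by one of two strategies: (i) $s_{\min}\le s^{(k)}\le B$ for every $k$, for a fixed $s_{\min}>0$; or (ii) $s^{(k)}=\alpha\|d\|$ with some $d\in\partial_x g(x^{(k)},t^{(k)})$ and a fixed $\alpha\in(0,1]$. *)

theory Defs
  imports "HOL-Analysis.Analysis"
begin

text \<open>
  Semi-infinite convex program: minimise the coordinate \<open>x $ i0\<close> over \<open>x \<in> X\<close> subject to
  \<open>g x t \<le> 0\<close> for all \<open>t \<in> T\<close>.  A finite index type carries no distinguished element, so the
  index \<open>i0\<close> of the objective coordinate is an explicit parameter throughout.
\<close>

definition eps_feasible ::
  "(real^'n) set \<Rightarrow> 't set \<Rightarrow> (real^'n \<Rightarrow> 't \<Rightarrow> real) \<Rightarrow> real \<Rightarrow> real^'n \<Rightarrow> bool" where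
  "eps_feasible X T g \<epsilon> x \<longleftrightarrow> x \<in> X \<and> (\<forall>t\<in>T. g x t \<le> \<epsilon>)"

definition optimal_solution ::
  "'n \<Rightarrow> (real^'n) set \<Rightarrow> 't set \<Rightarrow> (real^'n \<Rightarrow> 't \<Rightarrow> real) \<Rightarrow> real^'n \<Rightarrow> bool" where
  "optimal_solution i0 X T g x \<longleftrightarrow> is_arg_min (\<lambda>x. x $ i0) (eps_feasible X T g 0) x"

definition subdifferential :: "'a::real_inner set \<Rightarrow> ('a \<Rightarrow> real) \<Rightarrow> 'a \<Rightarrow> 'a set" where
  "subdifferential W f x = {d. \<forall>z\<in>W. f z \<ge> f x + d \<bullet> (z - x)}"

text \<open>
  \<open>W t\<close> is the open convex set containing \<open>X\<close> on which \<open>\<lambda>x. g x t\<close> is convex and with respect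
  to which its subgradients are taken; it is allowed to depend on \<open>t\<close>.
\<close>

definition assumption1 ::
  "(real^'n) set \<Rightarrow> 't set \<Rightarrow> (real^'n \<Rightarrow> 't \<Rightarrow> real) \<Rightarrow> ('t \<Rightarrow> (real^'n) set)
    \<Rightarrow> real^'n \<Rightarrow> real \<Rightarrow> real \<Rightarrow> bool" where
  "assumption1 X T g W xbar \<eta> B \<longleftrightarrow>
     convex X \<and> closed X \<and> bounded X \<and>
     xbar \<in> X \<and> \<eta> > 0 \<and> (\<forall>t\<in>T. g xbar t \<le> - \<eta>) \<and>
     (\<forall>t\<in>T. open (W t) \<and> convex (W t) \<and> X \<subseteq> W t \<and>
        convex_on (W t) (\<lambda>x. g x t) \<and>
        (\<forall>x\<in>W t. subdifferential (W t) (\<lambda>x. g x t) x \<noteq> {})) \<and>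
     B > 0 \<and>
     (\<forall>x\<in>X. \<forall>t\<in>T. \<forall>d\<in>subdifferential (W t) (\<lambda>x. g x t) x. norm d \<le> B)"

text \<open>
  The oracle may be nondeterministic: \<open>orc x\<close> is the set of its possible answers at \<open>x\<close>, where
  \<open>None\<close> is the report that no violated constraint was found.
\<close>

definition assumption2 ::
  "(real^'n) set \<Rightarrow> 't set \<Rightarrow> (real^'n \<Rightarrow> 't \<Rightarrow> real) \<Rightarrow> real
    \<Rightarrow> (real^'n \<Rightarrow> 't option set) \<Rightarrow> bool" where
  "assumption2 X T g \<epsilon> orc \<longleftrightarrow>
     (\<forall>x\<in>X. orc x \<noteq> {} \<and>
        (\<forall>t. Some t \<in> orc x \<longrightarrow> t \<in> T \<and> g x t > 0) \<and>
        (\<not> eps_feasible X T g \<epsilon> x \<longrightarrow> None \<notin> orc x))"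

text \<open>
  An execution is recorded by sequences indexed by the iteration number.  \<open>iter_cut e k\<close> is the oracle's
  answer in iteration \<open>k\<close>; \<open>iter_s e k\<close> is meaningful only if that answer is not \<open>None\<close>; \<open>iter_J e k\<close> is
  the index set at the end of iteration \<open>k\<close>, after cuts have been dropped.  Values belonging to
  iterations that are never reached, or to steps after the stopping test, are unconstrained.
\<close>

record ('n::finite, 't) execution =
  iter_x :: "nat \<Rightarrow> real^'n"
  iter_\<sigma> :: "nat \<Rightarrow> real"
  iter_cut :: "nat \<Rightarrow> 't option"
  iter_s :: "nat \<Rightarrow> real"
  iter_y :: "nat \<Rightarrow> real^'n"
  iter_J :: "nat \<Rightarrow> nat set"

definition reached :: "('n::finite, 't) execution \<Rightarrow> nat \<Rightarrow> bool" where
  "reached e k \<longleftrightarrow> 1 \<le> k \<and> (\<forall>j. 1 \<le> j \<and> j < k \<longrightarrow> iter_\<sigma> e j \<noteq> 0)"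

text \<open>Iteration \<open>k\<close> is reached and passes the stopping test, hence is carried out in full.\<close>

definition completed :: "('n::finite, 't) execution \<Rightarrow> nat \<Rightarrow> bool" where
  "completed e k \<longleftrightarrow> reached e k \<and> iter_\<sigma> e k \<noteq> 0"

definition master_feasible ::
  "'n \<Rightarrow> (real^'n) set \<Rightarrow> (real^'n \<Rightarrow> 't \<Rightarrow> real) \<Rightarrow> ('n, 't) execution \<Rightarrow> nat
    \<Rightarrow> (real^'n) \<times> real \<Rightarrow> bool" where
  "master_feasible i0 X g e k = (\<lambda>(z, \<rho>).
     z $ i0 + \<rho> \<le> iter_y e (k - 1) $ i0 \<and>
     (\<forall>j\<in>iter_J e (k - 1). g z (the (iter_cut e j)) + \<rho> * iter_s e j \<le> 0) \<and>
     z \<in> X)"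

definition cuts_before_drop :: "('n::finite, 't) execution \<Rightarrow> nat \<Rightarrow> nat set" where
  "cuts_before_drop e k =
     (if iter_cut e k = None then iter_J e (k - 1) else insert k (iter_J e (k - 1)))"

text \<open>
  The case \<open>\<beta> = \<infinity>\<close>, in which no cut is ever dropped, is treated separately: reading the
  condition \<open>\<sigma>\<^sub>j \<ge> \<beta> \<sigma>\<^sub>k\<close> in the extended reals would drop cuts when \<open>\<sigma>\<^sub>k < 0\<close>.
\<close>

definition dropped_cuts ::
  "(real^'n \<Rightarrow> 't \<Rightarrow> real) \<Rightarrow> ereal \<Rightarrow> ('n, 't) execution \<Rightarrow> nat \<Rightarrow> nat set" where
  "dropped_cuts g \<beta> e k =
     {j \<in> cuts_before_drop e k.
        \<beta> \<noteq> \<infinity> \<and> iter_\<sigma> e j \<ge> real_of_ereal \<beta> * iter_\<sigma> e k \<and>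
        g (iter_x e k) (the (iter_cut e j)) + iter_\<sigma> e k * iter_s e j < 0}"

definition cutting_surface_execution ::
  "'n \<Rightarrow> (real^'n) set \<Rightarrow> (real^'n \<Rightarrow> 't \<Rightarrow> real) \<Rightarrow> (real^'n \<Rightarrow> 't option set)
    \<Rightarrow> real \<Rightarrow> ereal \<Rightarrow> ('n, 't) execution \<Rightarrow> bool" where
  "cutting_surface_execution i0 X g orc U \<beta> e \<longleftrightarrow>
     iter_y e 0 = axis i0 U \<and> iter_J e 0 = {} \<and>
     (\<forall>k. reached e k \<longrightarrow>
        is_arg_max snd (master_feasible i0 X g e k) (iter_x e k, iter_\<sigma> e k)) \<and>
     (\<forall>k. completed e k \<longrightarrow>
        iter_cut e k \<in> orc (iter_x e k) \<and>
        iter_y e k = (if iter_cut e k = None then iter_x e k else iter_y e (k - 1)) \<and>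
        iter_J e k = cuts_before_drop e k - dropped_cuts g \<beta> e k)"

definition feasibility_cut :: "('n::finite, 't) execution \<Rightarrow> nat \<Rightarrow> bool" where
  "feasibility_cut e k \<longleftrightarrow> completed e k \<and> iter_cut e k \<noteq> None"

definition optimality_cut :: "('n::finite, 't) execution \<Rightarrow> nat \<Rightarrow> bool" where
  "optimality_cut e k \<longleftrightarrow> completed e k \<and> iter_cut e k = None"

definition bounded_centering :: "real \<Rightarrow> ('n::finite, 't) execution \<Rightarrow> bool" where
  "bounded_centering B e \<longleftrightarrow>
     (\<exists>s_min>0. \<forall>k. feasibility_cut e k \<longrightarrow> s_min \<le> iter_s e k \<and> iter_s e k \<le> B)"

definition subgradient_centering ::
  "(real^'n \<Rightarrow> 't \<Rightarrow> real) \<Rightarrow> ('t \<Rightarrow> (real^'n) set) \<Rightarrow> ('n, 't) execution \<Rightarrow> bool" where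
  "subgradient_centering g W e \<longleftrightarrow>
     (\<exists>\<alpha>. 0 < \<alpha> \<and> \<alpha> \<le> 1 \<and>
        (\<forall>k. feasibility_cut e k \<longrightarrow>
           (\<exists>d \<in> subdifferential (W (the (iter_cut e k)))
                    (\<lambda>z. g z (the (iter_cut e k))) (iter_x e k).
              iter_s e k = \<alpha> * norm d)))"

definition first_below :: "('n::finite, 't) execution \<Rightarrow> real \<Rightarrow> nat \<Rightarrow> bool" where
  "first_below e c k \<longleftrightarrow>
     reached e k \<and> iter_\<sigma> e k < c \<and> (\<forall>j. 1 \<le> j \<and> j < k \<longrightarrow> \<not> iter_\<sigma> e j < c)"

end

theory Submission
  imports Defs
begin

text \<open>
  Write \<open>D = y\<^sub>0 - x\<^sup>*\<^sub>0\<close> for the optimality gap of the incumbent \<open>y\<close> before an iteration.  The result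
  follows from a lower bound \<open>\<sigma> \<ge> c D\<close> on the optimal value of the master problem of that
  iteration, with \<open>c > 0\<close> independent of the iteration: if the iteration makes an optimality cut, the
  new incumbent is the first component of the master solution, so its objective is at most
  \<open>y\<^sub>0 - \<sigma>\<close>, and the gap shrinks to at most \<open>(1 - c) D\<close>.

  The lower bound comes from moving from the optimal solution towards the Slater point.  At
  \<open>z = (1 - \<theta>) x\<^sup>* + \<theta> xbar\<close> convexity gives every constraint the slack \<open>\<theta>\<eta>\<close>
  (\<open>segment_to_slater_point_slack\<close>).  As all centering parameters are at most \<open>B\<close>
  (\<open>centering_le_B\<close>), the pair \<open>(z, \<theta>\<eta>/B)\<close> satisfies every cut, whichever cuts have been
  kept.  The objective constraint of the master problem reads
  \<open>\<theta> (xbar\<^sub>0 - x\<^sup>*\<^sub>0 + \<eta>/B) \<le> D\<close>, so \<open>\<theta>\<close> may be taken proportional to \<open>D\<close>.  The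
  remaining requirement \<open>\<theta> \<le> 1\<close> is compatible with a fixed factor of proportionality because the
  gaps \<open>D\<close> are uniformly bounded: every incumbent is the initial one or a point of the bounded
  set \<open>X\<close> (\<open>incumbent_initial_or_in_X\<close>).
\<close>

lemma segment_to_slater_point_slack:
  assumes A1: "assumption1 X T g W xbar \<eta> B"
    and x: "eps_feasible X T g 0 x"
    and \<theta>: "0 \<le> \<theta>" "\<theta> \<le> 1"
  defines "z \<equiv> (1 - \<theta>) *\<^sub>R x + \<theta> *\<^sub>R xbar"
  shows "z \<in> X" and "t \<in> T \<Longrightarrow> g z t \<le> - (\<theta> * \<eta>)"
proof -
  have X: "x \<in> X" "xbar \<in> X" "convex X"
    using A1 x by (auto simp: assumption1_def eps_feasible_def)
  then show "z \<in> X"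
    unfolding z_def using \<theta> by (intro convexD) auto
  assume t: "t \<in> T"
  have "convex_on (W t) (\<lambda>x. g x t)" "x \<in> W t" "xbar \<in> W t"
    using A1 t X by (auto simp: assumption1_def)
  then have "g z t \<le> (1 - \<theta>) * g x t + \<theta> * g xbar t"
    unfolding z_def using \<theta> by (intro convex_onD) auto
  also have "\<dots> \<le> (1 - \<theta>) * 0 + \<theta> * (- \<eta>)"
    using A1 x t \<theta>
    by (intro add_mono mult_left_mono) (auto simp: assumption1_def eps_feasible_def)
  finally show "g z t \<le> - (\<theta> * \<eta>)" by simp
qed

lemma reached_Suc: "reached e (Suc k) \<longleftrightarrow> k = 0 \<or> completed e k"
  by (auto simp: reached_def completed_def less_Suc_eq)

lemma reached_master_solution:
  assumes "cutting_surface_execution i0 X g orc U \<beta> e" and "reached e k"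
  shows "iter_x e k \<in> X"
    and "iter_x e k $ i0 + iter_\<sigma> e k \<le> iter_y e (k - 1) $ i0"
    and "master_feasible i0 X g e k (z, \<rho>) \<Longrightarrow> \<rho> \<le> iter_\<sigma> e k"
proof -
  have "is_arg_max snd (master_feasible i0 X g e k) (iter_x e k, iter_\<sigma> e k)"
    using assms by (auto simp: cutting_surface_execution_def)
  then have sol: "master_feasible i0 X g e k (iter_x e k, iter_\<sigma> e k)"
    and "\<And>z \<rho>. master_feasible i0 X g e k (z, \<rho>) \<Longrightarrow> \<rho> \<le> iter_\<sigma> e k"
    by (auto simp: is_arg_max_def not_less)
  then show "master_feasible i0 X g e k (z, \<rho>) \<Longrightarrow> \<rho> \<le> iter_\<sigma> e k" by blast
  show "iter_x e k \<in> X"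
    and "iter_x e k $ i0 + iter_\<sigma> e k \<le> iter_y e (k - 1) $ i0"
    using sol by (auto simp: master_feasible_def)
qed

lemma feasibility_cut_index_in_T:
  assumes "assumption2 X T g \<epsilon> orc"
    and "cutting_surface_execution i0 X g orc U \<beta> e"
    and "feasibility_cut e j"
  shows "the (iter_cut e j) \<in> T"
proof -
  have "reached e j" "iter_cut e j \<in> orc (iter_x e j)" "iter_cut e j \<noteq> None"
    using assms by (auto simp: feasibility_cut_def completed_def cutting_surface_execution_def)
  moreover from this have "iter_x e j \<in> X"
    using reached_master_solution(1) assms(2) by blast
  ultimately show ?thesis
    using assms(1) by (auto simp: assumption2_def)
qed

lemma active_cuts_are_feasibility_cuts:
  assumes "cutting_surface_execution i0 X g orc U \<beta> e" and "reached e (Suc k)"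
  shows "iter_J e k \<subseteq> {j. feasibility_cut e j}"
  using assms(2)
proof (induction k)
  case 0
  then show ?case using assms(1) by (simp add: cutting_surface_execution_def)
next
  case (Suc k)
  then have k: "completed e (Suc k)" by (simp add: reached_Suc)
  then have "iter_J e (Suc k) \<subseteq> cuts_before_drop e (Suc k)"
    using assms(1) by (auto simp: cutting_surface_execution_def)
  also have "\<dots> \<subseteq> {j. feasibility_cut e j}"
    using Suc.IH k by (auto simp: cuts_before_drop_def feasibility_cut_def completed_def)
  finally show ?case .
qed

lemma incumbent_initial_or_in_X:
  assumes "cutting_surface_execution i0 X g orc U \<beta> e" and "reached e (Suc k)"
  shows "iter_y e k \<in> insert (axis i0 U) X"
  using assms(2)
proof (induction k)
  case 0
  then show ?case using assms(1) by (simp add: cutting_surface_execution_def)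
next
  case (Suc k)
  then have k: "completed e (Suc k)" "reached e (Suc k)"
    by (simp_all add: reached_Suc completed_def)
  then have "iter_y e (Suc k) = iter_x e (Suc k) \<or> iter_y e (Suc k) = iter_y e k"
    using assms(1) by (auto simp: cutting_surface_execution_def)
  then show ?case
    using Suc.IH k(2) reached_master_solution(1)[OF assms(1)] by auto
qed

text \<open>
  Under subgradient centering the bound is the uniform bound on subgradients at points of \<open>X\<close>,
  scaled by a factor \<open>\<alpha> \<le> 1\<close>; master solutions lie in \<open>X\<close> and the oracle answers with
  elements of \<open>T\<close>, so that bound applies.
\<close>

lemma centering_le_B:
  assumes A1: "assumption1 X T g W xbar \<eta> B"
    and A2: "assumption2 X T g \<epsilon> orc"
    and ex: "cutting_surface_execution i0 X g orc U \<beta> e"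
    and s: "bounded_centering B e \<or> subgradient_centering g W e"
    and j: "feasibility_cut e j"
  shows "iter_s e j \<le> B"
  using s
proof
  assume "bounded_centering B e"
  then show ?thesis using j by (auto simp: bounded_centering_def)
next
  assume "subgradient_centering g W e"
  then obtain \<alpha> d where \<alpha>: "0 < \<alpha>" "\<alpha> \<le> 1"
    and d: "d \<in> subdifferential (W (the (iter_cut e j)))
                    (\<lambda>z. g z (the (iter_cut e j))) (iter_x e j)"
    and sd: "iter_s e j = \<alpha> * norm d"
    using j unfolding subgradient_centering_def by blast
  have "iter_x e j \<in> X"
    using reached_master_solution(1)[OF ex] j by (auto simp: feasibility_cut_def completed_def)
  then have "norm d \<le> B"
    using A1 feasibility_cut_index_in_T[OF A2 ex j] d unfolding assumption1_def by blast
  moreover have "\<alpha> * norm d \<le> norm d"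
    using \<alpha> by (intro mult_left_le_one_le) auto
  ultimately show ?thesis using sd by linarith
qed

text \<open>
  A point of the segment from a feasible \<open>x\<close> to the Slater point satisfies every cut with
  \<open>\<sigma> = \<theta>\<eta>/B\<close>, so only the objective constraint limits \<open>\<theta>\<close>.
\<close>

lemma master_value_lower_bound:
  assumes A1: "assumption1 X T g W xbar \<eta> B"
    and A2: "assumption2 X T g \<epsilon> orc"
    and ex: "cutting_surface_execution i0 X g orc U \<beta> e"
    and s: "bounded_centering B e \<or> subgradient_centering g W e"
    and k: "reached e k"
    and x: "eps_feasible X T g 0 x"
    and \<theta>: "0 \<le> \<theta>" "\<theta> \<le> 1"
    and obj: "\<theta> * (xbar $ i0 - x $ i0 + \<eta> / B) \<le> iter_y e (k - 1) $ i0 - x $ i0"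
  shows "\<theta> * (\<eta> / B) \<le> iter_\<sigma> e k"
proof -
  define z where "z = (1 - \<theta>) *\<^sub>R x + \<theta> *\<^sub>R xbar"
  note slack = segment_to_slater_point_slack[OF A1 x \<theta>, folded z_def]
  have pos: "\<eta> > 0" "B > 0" using A1 by (auto simp: assumption1_def)
  have "z $ i0 + \<theta> * (\<eta> / B) \<le> iter_y e (k - 1) $ i0"
    using obj by (simp add: z_def algebra_simps)
  moreover have "g z (the (iter_cut e j)) + \<theta> * (\<eta> / B) * iter_s e j \<le> 0"
    if "j \<in> iter_J e (k - 1)" for j
  proof -
    have "Suc (k - 1) = k" using k by (simp add: reached_def)
    then have j: "feasibility_cut e j"
      using active_cuts_are_feasibility_cuts[OF ex, of "k - 1"] k that by auto
    have "\<theta> * (\<eta> / B) * iter_s e j \<le> \<theta> * (\<eta> / B) * B"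
      using centering_le_B[OF A1 A2 ex s j] \<theta> pos by (intro mult_left_mono) auto
    also have "\<dots> = \<theta> * \<eta>" using pos by simp
    finally show ?thesis
      using slack(2)[OF feasibility_cut_index_in_T[OF A2 ex j]] by linarith
  qed
  ultimately have "master_feasible i0 X g e k (z, \<theta> * (\<eta> / B))"
    using slack(1) by (simp add: master_feasible_def)
  then show ?thesis by (rule reached_master_solution(3)[OF ex k])
qed

theorem theorem8:
  fixes i0 :: "'n::finite"
    and X :: "(real^'n) set" and T :: "'t set" and g :: "real^'n \<Rightarrow> 't \<Rightarrow> real"
    and W :: "'t \<Rightarrow> (real^'n) set" and xbar xstar :: "real^'n"
    and \<eta> B \<epsilon> U :: real and \<beta> :: ereal
    and orc :: "real^'n \<Rightarrow> 't option set"
    and e :: "('n, 't) execution" and khat :: nat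
  assumes "assumption1 X T g W xbar \<eta> B"
    and "\<epsilon> \<ge> 0" and "assumption2 X T g \<epsilon> orc"
    and "optimal_solution i0 X T g xstar"
    and "U > xstar $ i0" and "\<beta> > 1"
    and "cutting_surface_execution i0 X g orc U \<beta> e"
    and "bounded_centering B e \<or> subgradient_centering g W e"
    and "first_below e (\<eta> / B) khat"
  shows "\<exists>q<1. \<forall>k>khat. optimality_cut e k \<and> iter_y e (k - 1) $ i0 > xstar $ i0 \<longrightarrow>
           (iter_y e k $ i0 - xstar $ i0) / (iter_y e (k - 1) $ i0 - xstar $ i0) \<le> q"
proof -
  note A1 = assms(1) and A2 = assms(3) and ex = assms(7) and cen = assms(8)
  have pos: "\<eta> > 0" "B > 0" and "bounded X"
    using A1 by (auto simp: assumption1_def)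
  have xstar: "eps_feasible X T g 0 xstar"
    and least: "\<And>x. eps_feasible X T g 0 x \<Longrightarrow> xstar $ i0 \<le> x $ i0"
    using assms(4) by (auto simp: optimal_solution_def is_arg_min_def not_less)
  have "eps_feasible X T g 0 xbar"
    using A1 unfolding assumption1_def eps_feasible_def by fastforce
  then have xbar: "xstar $ i0 \<le> xbar $ i0" by (rule least)

  have "bounded (insert (axis i0 U) X)" using \<open>bounded X\<close> by simp
  then obtain R where R: "\<And>y. y \<in> insert (axis i0 U) X \<Longrightarrow> norm y \<le> R"
    unfolding bounded_iff by blast

  \<comment> \<open>The step \<open>\<theta> = D / N\<close> has to satisfy \<open>\<theta> \<le> 1\<close>, where \<open>D \<le> R - x\<^sup>*\<^sub>0\<close>, and the
    objective constraint of the master problem.\<close>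
  define K where "K = xbar $ i0 - xstar $ i0 + \<eta> / B"
  define N where "N = max (R - xstar $ i0) K"
  have "K > 0" using xbar pos by (simp add: K_def add_nonneg_pos)
  then have N: "N > 0" "K \<le> N" "R - xstar $ i0 \<le> N" by (auto simp: N_def)
  define q where "q = 1 - \<eta> / B / N"
  have "q < 1" using pos N by (simp add: q_def)
  moreover have "(iter_y e k $ i0 - xstar $ i0) / (iter_y e (k - 1) $ i0 - xstar $ i0) \<le> q"
    if opt: "optimality_cut e k" and gap: "iter_y e (k - 1) $ i0 > xstar $ i0" for k
  proof -
    define D where "D = iter_y e (k - 1) $ i0 - xstar $ i0"
    have k: "completed e k" "reached e k" "iter_cut e k = None" "Suc (k - 1) = k"
      using opt by (auto simp: optimality_cut_def completed_def reached_def)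
    have "iter_y e (k - 1) $ i0 \<le> norm (iter_y e (k - 1))"
      using component_le_norm_cart[of "iter_y e (k - 1)" i0] by linarith
    also have "\<dots> \<le> R"
      using R incumbent_initial_or_in_X[OF ex, of "k - 1"] k by auto
    finally have D: "0 < D" "D \<le> N" using gap N by (auto simp: D_def)
    have "D / N * K \<le> D"
      using D N by (simp add: field_simps)
    then have "D / N * (\<eta> / B) \<le> iter_\<sigma> e k"
      using D N
      by (intro master_value_lower_bound[OF A1 A2 ex cen k(2) xstar])
         (auto simp: K_def D_def)
    moreover have "iter_y e k = iter_x e k"
      using ex k by (simp add: cutting_surface_execution_def)
    ultimately have "iter_y e k $ i0 - xstar $ i0 \<le> D - D / N * (\<eta> / B)"
      using reached_master_solution(2)[OF ex k(2)] by (simp add: D_def)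
    also have "\<dots> = q * D" by (simp add: q_def algebra_simps)
    finally show ?thesis
      using D(1) unfolding D_def[symmetric] by (simp add: pos_divide_le_eq)
  qed
  ultimately show ?thesis by blast
qed

end
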